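(* Let $\delta>0$, let $(X,d,\mu)$ be an Ahlfors $\delta$-regular metric-measure space and let $\Delta$ be its logarithmic Dirichlet Laplacian on $L^2(X,\mu)$. Let $h$ be a Dini continuous function on $(X,d)$. Then the multiplication operator $m_h$ on $L^2(X,\mu)$, $m_hf=hf$, maps $\operatorname{Dom}\Delta$ into $\operatorname{Dom}\Delta$, and the commutator $[\Delta,m_h]=\Delta m_h-m_h\Delta$, defined on $\operatorname{Dom}\Delta$, extends to a bounded operator on $L^2(X,\mu)$.
   Context: A metric-measure space is a triple $(X,d,\mu)$ where $(X,d)$ is a locally compact second-countable metric space and $\mu$ is a finite Borel measure on $X$. It is Ahlfors $\delta$-regular ($\delta>0$) if there is $C\ge 1$ such that $C^{-1}r^\delta\le\mu(\overline B(x,r))\le Cr^\delta$ for all $x\in X$ and $0\le r<\operatorname{diam}X$; then $\operatorname{diam} X<\infty$. $L^2(X,\mu)$ denotes the real Hilbert space of real-valued square-integrable functions. Define $$\operatorname{Dom}\mathcal E=\Big\{f\in L^2(X,\mu):\int_X\int_X\frac{|f(x)-f(y)|^2}{d(x,y)^\delta}\,d\mu(y)\,d\mu(x)<\infty\Big\},$$ $$\mathcal E(f,g)=\frac12\int_X\int_X\frac{(f(x)-f(y))(g(x)-g(y))}{d(x,y)^\delta}\,d\mu(y)\,d\mu(x),\qquad f,g\in\operatorname{Dom}\mathcal E,$$ the integrals being over the complement of the diagonal in $X\times X$. This is a densely defined closed form. The logarithmic Dirichlet Laplacian $\Delta$ is the positive self-adjoint operator associated with $\mathcal E$: if $R:L^2(X,\mu)\to\operatorname{Dom}\mathcal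 E$ is determined by $\langle Rf,g\rangle_{L^2}+\mathcal E(Rf,g)=\langle f,g\rangle_{L^2}$ for all $g\in\operatorname{Dom}\mathcal E$, then $\operatorname{Dom}\Delta=R(L^2(X,\mu))$ and $\Delta Rf=f-Rf$. Thus $R=(1+\Delta)^{-1}$, $\operatorname{Dom}\mathcal E=\operatorname{Dom}\Delta^{1/2}$ and $\mathcal E(f,g)=\langle\Delta^{1/2}f,\Delta^{1/2}g\rangle_{L^2}$. A bounded uniformly continuous function $h:X\to\mathbb R$ is Dini continuous if $\int_0^1\frac{\omega_h(t)}{t}\,dt<\infty$, where $\omega_h(t)=\sup\{|h(x)-h(y)|:d(x,y)\le t\operatorname{diam}(X)\}$ for $t\in[0,1]$. *)

theory Defs
  imports "HOL-Analysis.Analysis"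
begin

definition metric_measure_space ::
    "('a::{metric_space, second_countable_topology}) measure \<Rightarrow> bool" where
  "metric_measure_space \<mu> \<longleftrightarrow>
     locally compact (UNIV :: 'a set) \<and> sets \<mu> = sets borel \<and> finite_measure \<mu>"

text \<open>The library's \<open>diameter\<close> is 0 on unbounded sets. The guard below makes the radius
  unrestricted when the space is unbounded, that is, when its diameter is infinite. The lower bound
  is then incompatible with finiteness of the measure, so regularity forces boundedness.\<close>

definition ahlfors_regular :: "real \<Rightarrow> ('a::metric_space) measure \<Rightarrow> bool" where
  "ahlfors_regular \<delta> \<mu> \<longleftrightarrow>
     (\<exists>C\<ge>1. \<forall>x r. 0 \<le> r \<and> (bounded (UNIV :: 'a set) \<longrightarrow> r < diameter (UNIV :: 'a set)) \<longrightarrow>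
        inverse C * r powr \<delta> \<le> measure \<mu> (cball x r) \<and> measure \<mu> (cball x r) \<le> C * r powr \<delta>)"

text \<open>Elements of \<open>L\<^sup>2\<close> are represented by square-integrable functions; equality in \<open>L\<^sup>2\<close> is
  equality almost everywhere, and operators act on representatives.\<close>

definition L2 :: "'a measure \<Rightarrow> ('a \<Rightarrow> real) set" where
  "L2 \<mu> = {f \<in> borel_measurable \<mu>. integrable \<mu> (\<lambda>x. (f x)\<^sup>2)}"

definition L2_inner :: "'a measure \<Rightarrow> ('a \<Rightarrow> real) \<Rightarrow> ('a \<Rightarrow> real) \<Rightarrow> real" where
  "L2_inner \<mu> f g = (LINT x|\<mu>. f x * g x)"

definition L2_norm :: "'a measure \<Rightarrow> ('a \<Rightarrow> real) \<Rightarrow> real" where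
  "L2_norm \<mu> f = sqrt (L2_inner \<mu> f f)"

definition L2_bounded_operator ::
    "'a measure \<Rightarrow> (('a \<Rightarrow> real) \<Rightarrow> ('a \<Rightarrow> real)) \<Rightarrow> bool" where
  "L2_bounded_operator \<mu> T \<longleftrightarrow>
     (\<forall>f\<in>L2 \<mu>. T f \<in> L2 \<mu>) \<and>
     (\<forall>f\<in>L2 \<mu>. \<forall>g\<in>L2 \<mu>. (AE x in \<mu>. f x = g x) \<longrightarrow> (AE x in \<mu>. T f x = T g x)) \<and>
     (\<forall>f\<in>L2 \<mu>. \<forall>g\<in>L2 \<mu>. AE x in \<mu>. T (\<lambda>y. f y + g y) x = T f x + T g x) \<and>
     (\<forall>c. \<forall>f\<in>L2 \<mu>. AE x in \<mu>. T (\<lambda>y. c * f y) x = c * T f x) \<and>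
     (\<exists>K. \<forall>f\<in>L2 \<mu>. L2_norm \<mu> (T f) \<le> K * L2_norm \<mu> f)"

definition dom_form :: "real \<Rightarrow> ('a::metric_space) measure \<Rightarrow> ('a \<Rightarrow> real) set" where
  "dom_form \<delta> \<mu> = {f \<in> L2 \<mu>.
     (\<integral>\<^sup>+x. (\<integral>\<^sup>+y\<in>-{x}. ennreal (\<bar>f x - f y\<bar>\<^sup>2 / dist x y powr \<delta>) \<partial>\<mu>) \<partial>\<mu>) < \<infinity>}"

definition log_form ::
    "real \<Rightarrow> ('a::metric_space) measure \<Rightarrow> ('a \<Rightarrow> real) \<Rightarrow> ('a \<Rightarrow> real) \<Rightarrow> real" where
  "log_form \<delta> \<mu> f g =
     1 / 2 * (LINT x|\<mu>. (LINT y:-{x}|\<mu>. (f x - f y) * (g x - g y) / dist x y powr \<delta>))"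

text \<open>\<open>is_resolvent \<delta> \<mu> f u\<close> means that \<open>u\<close> represents \<open>R f\<close>, where \<open>R\<close> is the operator
  \<open>(1 + \<Delta>)\<^sup>-\<^sup>1\<close>. For given \<open>f\<close>, the function \<open>u\<close> is determined up to null sets; and since the form
  is densely defined, \<open>u\<close> in turn determines \<open>f\<close> up to null sets. Hence the choice made in
  \<open>log_laplacian\<close>, which encodes \<open>\<Delta> (R f) = f - R f\<close>, is immaterial.\<close>

definition is_resolvent ::
    "real \<Rightarrow> ('a::metric_space) measure \<Rightarrow> ('a \<Rightarrow> real) \<Rightarrow> ('a \<Rightarrow> real) \<Rightarrow> bool" where
  "is_resolvent \<delta> \<mu> f u \<longleftrightarrow> f \<in> L2 \<mu> \<and> u \<in> dom_form \<delta> \<mu> \<and>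
     (\<forall>g\<in>dom_form \<delta> \<mu>. L2_inner \<mu> u g + log_form \<delta> \<mu> u g = L2_inner \<mu> f g)"

definition dom_laplacian :: "real \<Rightarrow> ('a::metric_space) measure \<Rightarrow> ('a \<Rightarrow> real) set" where
  "dom_laplacian \<delta> \<mu> = {u. \<exists>f. is_resolvent \<delta> \<mu> f u}"

definition log_laplacian ::
    "real \<Rightarrow> ('a::metric_space) measure \<Rightarrow> ('a \<Rightarrow> real) \<Rightarrow> ('a \<Rightarrow> real)" where
  "log_laplacian \<delta> \<mu> u = (\<lambda>x. (SOME f. is_resolvent \<delta> \<mu> f u) x - u x)"

definition mult_op :: "('a \<Rightarrow> real) \<Rightarrow> ('a \<Rightarrow> real) \<Rightarrow> ('a \<Rightarrow> real)" where
  "mult_op h f = (\<lambda>x. h x * f x)"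

definition commutator ::
    "(('a \<Rightarrow> real) \<Rightarrow> ('a \<Rightarrow> real)) \<Rightarrow> (('a \<Rightarrow> real) \<Rightarrow> ('a \<Rightarrow> real)) \<Rightarrow> ('a \<Rightarrow> real) \<Rightarrow> ('a \<Rightarrow> real)" where
  "commutator A B f = (\<lambda>x. A (B f) x - B (A f) x)"

text \<open>The next two definitions are meant for spaces of finite diameter.\<close>

definition modulus_of_continuity :: "('a::metric_space \<Rightarrow> real) \<Rightarrow> real \<Rightarrow> real" where
  "modulus_of_continuity h t =
     Sup {\<bar>h x - h y\<bar> | x y. dist x y \<le> t * diameter (UNIV :: 'a set)}"

definition dini_continuous :: "('a::metric_space \<Rightarrow> real) \<Rightarrow> bool" where
  "dini_continuous h \<longleftrightarrow>
     bounded (range h) \<and> uniformly_continuous_on UNIV h \<and>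
     (\<integral>\<^sup>+t\<in>{0<..1}. ennreal (modulus_of_continuity h t / t) \<partial>lborel) < \<infinity>"

end

theory Submission
  imports Defs
begin

text \<open>
  Formally \<open>\<Delta> f x = \<integral> (f x - f y) / d(x, y)\<^sup>\<delta> d\<mu>(y)\<close>, and then \<open>\<Delta> (h f) - h \<Delta> f\<close> is the integral
  operator \<open>T f x = \<integral> k(x, y) f y d\<mu>(y)\<close> with the kernel \<open>k(x, y) = (h x - h y) / d(x, y)\<^sup>\<delta>\<close>. The proof
  shows that \<open>T\<close> is bounded on \<open>L\<^sup>2\<close> and that the formal identity is true in the weak sense that
  defines \<open>\<Delta>\<close>.

  Boundedness is the Schur test. Since \<open>\<bar>k\<bar>\<close> is symmetric, it suffices to bound
  \<open>\<integral> \<bar>k(x, y)\<bar> d\<mu>(y)\<close> uniformly in \<open>x\<close>. On the annulus \<open>2\<^sup>-\<^sup>n\<^sup>-\<^sup>1 D < d(x, y) \<le> 2\<^sup>-\<^sup>n D\<close>, with \<open>D\<close> the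
  diameter, the numerator is at most \<open>\<omega>(2\<^sup>-\<^sup>n)\<close>, the measure of the annulus is at most a
  constant times \<open>(2\<^sup>-\<^sup>n D)\<^sup>\<delta>\<close>, and the denominator is at least a constant times the same power, so
  that the powers cancel. What remains is \<open>\<Sum>\<^sub>n \<omega>(2\<^sup>-\<^sup>n)\<close>, which
  is finite by the Dini condition (lemmas \<open>summable_modulus\<close> and \<open>dini_row_bound\<close>).

  The weak identity is \<open>\<E>(h f, g) = \<E>(f, h g) + \<langle>T f, g\<rangle>\<close> (lemma \<open>log_form_mult_op\<close>). It makes sense
  because the Schur bound also shows that multiplication by \<open>h\<close> preserves the form domain. If now
  \<open>u = R F\<close>, then testing the equation for \<open>u\<close> against \<open>h g\<close> gives \<open>h u = R (h F + T u)\<close>. So \<open>h u\<close> lies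
  in the domain of \<open>\<Delta>\<close>, and \<open>\<Delta> (h u) - h \<Delta> u = (h F + T u - h u) - h (F - u) = T u\<close>.

  The last computation needs that \<open>R\<close> is injective, that is, that the form domain is dense.
  Bounded Lipschitz functions are Dini continuous, and multiplying the constant \<open>1\<close> by them shows
  that they belong to the form domain; a function orthogonal to all of them integrates to zero over
  every open set, hence over every Borel set, and therefore vanishes almost everywhere.
\<close>

section \<open>Square-integrable functions\<close>

text \<open>Second countability makes the product \<open>\<sigma>\<close>-algebra contain the Borel sets of
  \<open>X \<times> X\<close>, so that the distance is a measurable function of two variables.\<close>

locale finite_borel_space = finite_measure \<mu>
  for \<mu> :: "'a::{metric_space, second_countable_topology} measure" +
  assumes sets_eq_borel[measurable_cong]: "sets \<mu> = sets borel"
begin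

sublocale pair: pair_sigma_finite \<mu> \<mu> ..

lemma space_eq_UNIV [simp]: "space \<mu> = UNIV"
  using sets_eq_imp_space_eq[OF sets_eq_borel] by simp

end

lemma L2_measurable [measurable_dest]: "f \<in> L2 \<mu> \<Longrightarrow> f \<in> borel_measurable \<mu>"
  by (simp add: L2_def)

lemma L2_integrable_square: "f \<in> L2 \<mu> \<Longrightarrow> integrable \<mu> (\<lambda>x. (f x)\<^sup>2)"
  by (simp add: L2_def)

lemma abs_mult_le_half_squares: "\<bar>a * b\<bar> \<le> (a\<^sup>2 + b\<^sup>2) / (2::real)"
  using sum_squares_bound[of "\<bar>a\<bar>" "\<bar>b\<bar>"] by (simp add: abs_mult)

lemma square_add_le: "(a + b)\<^sup>2 \<le> 2 * a\<^sup>2 + 2 * (b::real)\<^sup>2"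
  using sum_squares_bound[of a b] by (simp add: power2_sum)

lemma L2_integrable_mult:
  assumes "f \<in> L2 \<mu>" "g \<in> L2 \<mu>"
  shows "integrable \<mu> (\<lambda>x. f x * g x)"
proof (rule Bochner_Integration.integrable_bound)
  show "integrable \<mu> (\<lambda>x. ((f x)\<^sup>2 + (g x)\<^sup>2) / 2)"
    using assms by (intro integrable_divide Bochner_Integration.integrable_add L2_integrable_square)
  show "(\<lambda>x. f x * g x) \<in> borel_measurable \<mu>"
    using assms by measurable
  have "norm (f x * g x) \<le> norm (((f x)\<^sup>2 + (g x)\<^sup>2) / 2)" for x
    using abs_mult_le_half_squares[of "f x" "g x"] by simp
  then show "AE x in \<mu>. norm (f x * g x) \<le> norm (((f x)\<^sup>2 + (g x)\<^sup>2) / 2)"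
    by simp
qed

lemma L2_add:
  assumes "f \<in> L2 \<mu>" "g \<in> L2 \<mu>"
  shows "(\<lambda>x. f x + g x) \<in> L2 \<mu>"
  unfolding L2_def
proof safe
  show [measurable]: "(\<lambda>x. f x + g x) \<in> borel_measurable \<mu>"
    using assms by measurable
  show "integrable \<mu> (\<lambda>x. (f x + g x)\<^sup>2)"
  proof (rule Bochner_Integration.integrable_bound)
    show "integrable \<mu> (\<lambda>x. 2 * (f x)\<^sup>2 + 2 * (g x)\<^sup>2)"
      using assms
      by (intro integrable_mult_right Bochner_Integration.integrable_add L2_integrable_square)
  qed (auto intro!: AE_I2 square_add_le)
qed

lemma L2_mult_bounded:
  assumes "f \<in> L2 \<mu>" and h[measurable]: "h \<in> borel_measurable \<mu>" and b: "\<And>x. \<bar>h x\<bar> \<le> B"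
  shows "mult_op h f \<in> L2 \<mu>"
  unfolding L2_def mult_op_def
proof safe
  note [measurable] = L2_measurable[OF assms(1)]
  show "(\<lambda>x. h x * f x) \<in> borel_measurable \<mu>"
    by measurable
  show "integrable \<mu> (\<lambda>x. (h x * f x)\<^sup>2)"
  proof (rule Bochner_Integration.integrable_bound)
    show "integrable \<mu> (\<lambda>x. B\<^sup>2 * (f x)\<^sup>2)"
      using assms by (intro integrable_mult_right L2_integrable_square)
    show "AE x in \<mu>. norm ((h x * f x)\<^sup>2) \<le> norm (B\<^sup>2 * (f x)\<^sup>2)"
      using b by (auto intro!: AE_I2 mult_right_mono abs_le_square_iff[THEN iffD1]
          simp: power_mult_distrib abs_le_iff intro: order_trans[OF b abs_ge_self])
  qed measurable
qed

section \<open>The Schur test for antisymmetric kernels\<close>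

text \<open>By antisymmetry the row bound is at the same time a column bound.\<close>

locale schur_kernel = finite_borel_space \<mu>
  for \<mu> :: "'a::{metric_space, second_countable_topology} measure" +
  fixes k :: "'a \<Rightarrow> 'a \<Rightarrow> real" and M :: real
  assumes kernel_measurable[measurable]: "(\<lambda>(x, y). k x y) \<in> borel_measurable (\<mu> \<Otimes>\<^sub>M \<mu>)"
    and antisymmetric: "k x y = - k y x"
    and row_bound: "(\<integral>\<^sup>+y. ennreal \<bar>k x y\<bar> \<partial>\<mu>) \<le> ennreal M"
    and bound_pos: "M > 0"
begin

definition integral_op :: "('a \<Rightarrow> real) \<Rightarrow> 'a \<Rightarrow> real" where
  "integral_op f x = (LINT y|\<mu>. k x y * f y)"

lemma kernel_measurable_compose [measurable (raw)]:
  "u \<in> measurable N \<mu> \<Longrightarrow> v \<in> measurable N \<mu> \<Longrightarrow> (\<lambda>z. k (u z) (v z)) \<in> borel_measurable N"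
  using measurable_compose[OF measurable_Pair kernel_measurable, of u N v] by simp

lemma abs_kernel_symmetric: "\<bar>k x y\<bar> = \<bar>k y x\<bar>"
  using antisymmetric[of x y] by simp

text \<open>Tonelli moves the integration over \<open>x\<close> inside, where the column bound applies.\<close>

lemma nn_integral_kernel_square_le:
  assumes [measurable]: "f \<in> borel_measurable \<mu>"
  shows "(\<integral>\<^sup>+x. \<integral>\<^sup>+y. ennreal (\<bar>k x y\<bar> * (f y)\<^sup>2) \<partial>\<mu> \<partial>\<mu>) \<le> ennreal M * (\<integral>\<^sup>+y. ennreal ((f y)\<^sup>2) \<partial>\<mu>)"
proof -
  have "(\<integral>\<^sup>+x. \<integral>\<^sup>+y. ennreal (\<bar>k x y\<bar> * (f y)\<^sup>2) \<partial>\<mu> \<partial>\<mu>)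
      = (\<integral>\<^sup>+y. \<integral>\<^sup>+x. ennreal (\<bar>k x y\<bar> * (f y)\<^sup>2) \<partial>\<mu> \<partial>\<mu>)"
    by (intro pair.Fubini'[symmetric]) measurable
  also have "\<dots> = (\<integral>\<^sup>+y. (\<integral>\<^sup>+x. ennreal \<bar>k y x\<bar> \<partial>\<mu>) * ennreal ((f y)\<^sup>2) \<partial>\<mu>)"
    by (subst nn_integral_multc[symmetric])
       (auto simp: ennreal_mult' abs_kernel_symmetric[of _ "_::'a"] intro!: nn_integral_cong)
  also have "\<dots> \<le> (\<integral>\<^sup>+y. ennreal M * ennreal ((f y)\<^sup>2) \<partial>\<mu>)"
    by (intro nn_integral_mono mult_right_mono row_bound) auto
  also have "\<dots> = ennreal M * (\<integral>\<^sup>+y. ennreal ((f y)\<^sup>2) \<partial>\<mu>)"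
    by (intro nn_integral_cmult) measurable
  finally show ?thesis .
qed

lemma integrable_kernel_square:
  assumes "f \<in> L2 \<mu>"
  shows "integrable (\<mu> \<Otimes>\<^sub>M \<mu>) (\<lambda>(x, y). \<bar>k x y\<bar> * (f y)\<^sup>2)"
    and "integrable (\<mu> \<Otimes>\<^sub>M \<mu>) (\<lambda>(x, y). \<bar>k x y\<bar> * (f x)\<^sup>2)"
proof -
  note [measurable] = L2_measurable[OF assms]
  have "(\<integral>\<^sup>+z. ennreal (norm (case z of (x, y) \<Rightarrow> \<bar>k x y\<bar> * (f y)\<^sup>2)) \<partial>(\<mu> \<Otimes>\<^sub>M \<mu>))
      = (\<integral>\<^sup>+x. \<integral>\<^sup>+y. ennreal (\<bar>k x y\<bar> * (f y)\<^sup>2) \<partial>\<mu> \<partial>\<mu>)"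
    by (subst nn_integral_fst[symmetric]) (auto simp: abs_mult)
  also have "\<dots> \<le> ennreal M * (\<integral>\<^sup>+y. ennreal ((f y)\<^sup>2) \<partial>\<mu>)"
    by (rule nn_integral_kernel_square_le) measurable
  also have "\<dots> < \<infinity>"
    using L2_integrable_square[OF assms]
    by (auto simp: ennreal_mult_less_top integrable_iff_bounded)
  finally show *: "integrable (\<mu> \<Otimes>\<^sub>M \<mu>) (\<lambda>(x, y). \<bar>k x y\<bar> * (f y)\<^sup>2)"
    by (intro integrableI_bounded) measurable
  show "integrable (\<mu> \<Otimes>\<^sub>M \<mu>) (\<lambda>(x, y). \<bar>k x y\<bar> * (f x)\<^sup>2)"
    using pair.integrable_product_swap[OF *]
    by (subst abs_kernel_symmetric) (simp add: case_prod_beta)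
qed

text \<open>Absolute convergence of the double integral is what allows Fubini and the swap of variables
  below; it follows from \<open>\<bar>f y * g x\<bar> \<le> ((f y)\<^sup>2 + (g x)\<^sup>2) / 2\<close>.\<close>

lemma integrable_bilinear:
  assumes "f \<in> L2 \<mu>" "g \<in> L2 \<mu>"
  shows "integrable (\<mu> \<Otimes>\<^sub>M \<mu>) (\<lambda>(x, y). k x y * f y * g x)"
proof (rule Bochner_Integration.integrable_bound)
  note [measurable] = assms[THEN L2_measurable]
  show "integrable (\<mu> \<Otimes>\<^sub>M \<mu>)
      (\<lambda>z. ((case z of (x, y) \<Rightarrow> \<bar>k x y\<bar> * (f y)\<^sup>2) + (case z of (x, y) \<Rightarrow> \<bar>k x y\<bar> * (g x)\<^sup>2)) / 2)"
    using assms
    by (intro integrable_divide Bochner_Integration.integrable_add integrable_kernel_square)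
  show "(\<lambda>(x, y). k x y * f y * g x) \<in> borel_measurable (\<mu> \<Otimes>\<^sub>M \<mu>)"
    by measurable
  have "\<bar>k x y * f y * g x\<bar> \<le> (\<bar>k x y\<bar> * (f y)\<^sup>2 + \<bar>k x y\<bar> * (g x)\<^sup>2) / 2" for x y
    using mult_left_mono[OF abs_mult_le_half_squares[of "f y" "g x"] abs_ge_zero[of "k x y"]]
    by (simp add: abs_mult algebra_simps)
  then show "AE z in \<mu> \<Otimes>\<^sub>M \<mu>. norm (case z of (x, y) \<Rightarrow> k x y * f y * g x) \<le> norm
      (((case z of (x, y) \<Rightarrow> \<bar>k x y\<bar> * (f y)\<^sup>2) + (case z of (x, y) \<Rightarrow> \<bar>k x y\<bar> * (g x)\<^sup>2)) / 2)"
    by (auto intro!: AE_I2)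
qed

lemma AE_integrable_row:
  assumes "f \<in> L2 \<mu>"
  shows "AE x in \<mu>. integrable \<mu> (\<lambda>y. k x y * f y)"
proof -
  have "(\<lambda>_. 1) \<in> L2 \<mu>"
    by (simp add: L2_def)
  from pair.AE_integrable_fst[OF integrable_bilinear[OF assms this]] show ?thesis
    by simp
qed

lemma integral_op_measurable [measurable (raw)]:
  assumes [measurable]: "f \<in> borel_measurable \<mu>"
  shows "integral_op f \<in> borel_measurable \<mu>"
  unfolding integral_op_def by measurable

text \<open>Cauchy--Schwarz with \<open>\<bar>k\<bar> * \<bar>f\<bar> = sqrt \<bar>k\<bar> * (sqrt \<bar>k\<bar> * \<bar>f\<bar>)\<close>. At a point where the row is not
  integrable against \<open>f\<close>, the Bochner integral has the value 0 and the bound is trivial.\<close>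

lemma integral_op_square_le:
  assumes [measurable]: "f \<in> borel_measurable \<mu>"
  shows "ennreal ((integral_op f x)\<^sup>2) \<le> ennreal M * (\<integral>\<^sup>+y. ennreal (\<bar>k x y\<bar> * (f y)\<^sup>2) \<partial>\<mu>)"
proof -
  let ?r = "\<lambda>y. ennreal (sqrt \<bar>k x y\<bar>)"
  have "ennreal \<bar>integral_op f x\<bar> \<le> (\<integral>\<^sup>+y. ennreal \<bar>k x y * f y\<bar> \<partial>\<mu>)"
    unfolding integral_op_def
    using integral_norm_bound_ennreal[of \<mu> "\<lambda>y. k x y * f y"] not_integrable_integral_eq[of \<mu> "\<lambda>y. k x y * f y"]
    by (cases "integrable \<mu> (\<lambda>y. k x y * f y)") auto
  also have "\<dots> = (\<integral>\<^sup>+y. ?r y * (?r y * ennreal \<bar>f y\<bar>) \<partial>\<mu>)"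
    by (intro nn_integral_cong)
       (simp add: ennreal_mult'[symmetric] abs_mult mult.assoc[symmetric])
  finally have "(ennreal \<bar>integral_op f x\<bar>)\<^sup>2 \<le> (\<integral>\<^sup>+y. ?r y * (?r y * ennreal \<bar>f y\<bar>) \<partial>\<mu>)\<^sup>2"
    by (rule power_mono) simp
  also have "\<dots> \<le> (\<integral>\<^sup>+y. (?r y)\<^sup>2 \<partial>\<mu>) * (\<integral>\<^sup>+y. (?r y * ennreal \<bar>f y\<bar>)\<^sup>2 \<partial>\<mu>)"
    by (rule Cauchy_Schwarz_nn_integral) measurable
  also have "(\<integral>\<^sup>+y. (?r y)\<^sup>2 \<partial>\<mu>) = (\<integral>\<^sup>+y. ennreal \<bar>k x y\<bar> \<partial>\<mu>)"
    by (simp add: ennreal_power)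
  also have "(\<integral>\<^sup>+y. (?r y * ennreal \<bar>f y\<bar>)\<^sup>2 \<partial>\<mu>) = (\<integral>\<^sup>+y. ennreal (\<bar>k x y\<bar> * (f y)\<^sup>2) \<partial>\<mu>)"
    by (simp add: power_mult_distrib ennreal_power ennreal_mult')
  also have "(\<integral>\<^sup>+y. ennreal \<bar>k x y\<bar> \<partial>\<mu>) * (\<integral>\<^sup>+y. ennreal (\<bar>k x y\<bar> * (f y)\<^sup>2) \<partial>\<mu>)
      \<le> ennreal M * (\<integral>\<^sup>+y. ennreal (\<bar>k x y\<bar> * (f y)\<^sup>2) \<partial>\<mu>)"
    by (intro mult_right_mono row_bound) simp
  finally show ?thesis
    by (simp add: ennreal_power)
qed

lemma nn_integral_integral_op_square_le:
  assumes [measurable]: "f \<in> borel_measurable \<mu>"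
  shows "(\<integral>\<^sup>+x. ennreal ((integral_op f x)\<^sup>2) \<partial>\<mu>) \<le> ennreal (M\<^sup>2) * (\<integral>\<^sup>+y. ennreal ((f y)\<^sup>2) \<partial>\<mu>)"
proof -
  have "(\<integral>\<^sup>+x. ennreal ((integral_op f x)\<^sup>2) \<partial>\<mu>)
      \<le> (\<integral>\<^sup>+x. ennreal M * (\<integral>\<^sup>+y. ennreal (\<bar>k x y\<bar> * (f y)\<^sup>2) \<partial>\<mu>) \<partial>\<mu>)"
    by (intro nn_integral_mono integral_op_square_le) measurable
  also have "\<dots> = ennreal M * (\<integral>\<^sup>+x. (\<integral>\<^sup>+y. ennreal (\<bar>k x y\<bar> * (f y)\<^sup>2) \<partial>\<mu>) \<partial>\<mu>)"
    by (rule nn_integral_cmult) measurable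
  also have "\<dots> \<le> ennreal M * (ennreal M * (\<integral>\<^sup>+y. ennreal ((f y)\<^sup>2) \<partial>\<mu>))"
    by (intro mult_left_mono nn_integral_kernel_square_le) auto
  also have "\<dots> = ennreal (M\<^sup>2) * (\<integral>\<^sup>+y. ennreal ((f y)\<^sup>2) \<partial>\<mu>)"
    using bound_pos by (simp add: power2_eq_square ennreal_mult' mult.assoc)
  finally show ?thesis .
qed

lemma integral_op_L2:
  assumes "f \<in> L2 \<mu>"
  shows "integral_op f \<in> L2 \<mu>" and "L2_norm \<mu> (integral_op f) \<le> M * L2_norm \<mu> f"
proof -
  note [measurable] = L2_measurable[OF assms]
  note le = nn_integral_integral_op_square_le[of f]
  have f: "(\<integral>\<^sup>+y. ennreal ((f y)\<^sup>2) \<partial>\<mu>) = ennreal (LINT y|\<mu>. (f y)\<^sup>2)"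
    using L2_integrable_square[OF assms] by (intro nn_integral_eq_integral) auto
  have int: "integrable \<mu> (\<lambda>x. (integral_op f x)\<^sup>2)"
  proof (rule integrableI_bounded)
    show "(\<integral>\<^sup>+x. ennreal (norm ((integral_op f x)\<^sup>2)) \<partial>\<mu>) < \<infinity>"
      using le unfolding f by (auto simp: ennreal_mult'[symmetric] intro: le_less_trans)
  qed measurable
  then show "integral_op f \<in> L2 \<mu>"
    by (simp add: L2_def)
  have "ennreal (LINT x|\<mu>. (integral_op f x)\<^sup>2) \<le> ennreal (M\<^sup>2 * (LINT y|\<mu>. (f y)\<^sup>2))"
    using le unfolding f by (subst nn_integral_eq_integral[symmetric, OF int]) (auto simp: ennreal_mult')
  then have "(LINT x|\<mu>. (integral_op f x)\<^sup>2) \<le> M\<^sup>2 * (LINT y|\<mu>. (f y)\<^sup>2)"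
    by (simp add: ennreal_le_iff)
  then show "L2_norm \<mu> (integral_op f) \<le> M * L2_norm \<mu> f"
    using bound_pos real_sqrt_le_mono
    by (fastforce simp: L2_norm_def L2_inner_def power2_eq_square[symmetric] real_sqrt_mult)
qed

lemma integral_op_bounded: "L2_bounded_operator \<mu> integral_op"
  unfolding L2_bounded_operator_def
proof (intro conjI ballI allI impI)
  show "\<exists>K. \<forall>f\<in>L2 \<mu>. L2_norm \<mu> (integral_op f) \<le> K * L2_norm \<mu> f"
    using integral_op_L2(2) by blast
next
  fix f g assume fg: "f \<in> L2 \<mu>" "g \<in> L2 \<mu>"
  note [measurable] = fg[THEN L2_measurable]
  show "AE x in \<mu>. integral_op (\<lambda>y. f y + g y) x = integral_op f x + integral_op g x"
    using AE_integrable_row[OF fg(1)] AE_integrable_row[OF fg(2)]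
    by eventually_elim (simp add: integral_op_def distrib_left)
  show "AE x in \<mu>. integral_op f x = integral_op g x" if "AE x in \<mu>. f x = g x"
  proof -
    have "AE y in \<mu>. k x y * f y = k x y * g y" for x
      using that by eventually_elim simp
    then have "integral_op f x = integral_op g x" for x
      unfolding integral_op_def by (intro integral_cong_AE) measurable
    then show ?thesis
      by simp
  qed
qed (auto simp: integral_op_L2 integral_op_def mult.left_commute)

lemma L2_inner_integral_op:
  assumes "f \<in> L2 \<mu>" "g \<in> L2 \<mu>"
  shows "L2_inner \<mu> (integral_op f) g = (\<integral>(x, y). k x y * f y * g x \<partial>(\<mu> \<Otimes>\<^sub>M \<mu>))"
  unfolding pair.integral_fst[OF integrable_bilinear[OF assms], symmetric]
  by (simp add: L2_inner_def integral_op_def)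

text \<open>The left-hand side is \<open>\<langle>T g, f\<rangle>\<close> for the integral operator \<open>T\<close>, which is thus skew-adjoint.\<close>

lemma LINT_kernel_swap:
  assumes "f \<in> L2 \<mu>" "g \<in> L2 \<mu>"
  shows "(\<integral>(x, y). k x y * f x * g y \<partial>(\<mu> \<Otimes>\<^sub>M \<mu>)) = - L2_inner \<mu> (integral_op f) g"
proof -
  note [measurable] = assms[THEN L2_measurable]
  have "(\<integral>(x, y). k x y * f x * g y \<partial>(\<mu> \<Otimes>\<^sub>M \<mu>)) = (\<integral>(x, y). k y x * f y * g x \<partial>(\<mu> \<Otimes>\<^sub>M \<mu>))"
    by (subst pair.integral_product_swap[symmetric]) (auto simp: split_beta')
  also have "\<dots> = (\<integral>(x, y). - (k x y * f y * g x) \<partial>(\<mu> \<Otimes>\<^sub>M \<mu>))"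
    by (subst antisymmetric) simp
  also have "\<dots> = - L2_inner \<mu> (integral_op f) g"
    unfolding L2_inner_integral_op[OF assms] by (simp add: split_beta')
  finally show ?thesis .
qed

end


section \<open>The form as an integral over the product space\<close>

context finite_borel_space
begin

text \<open>All integrands of the form vanish on the diagonal, since their numerators do; excluding the
  diagonal from the domain of integration therefore changes nothing.\<close>

lemma nn_integral_off_diagonal:
  assumes "g x = 0"
  shows "(\<integral>\<^sup>+y\<in>-{x}. ennreal (g y) \<partial>\<mu>) = (\<integral>\<^sup>+y. ennreal (g y) \<partial>\<mu>)"
  using assms by (intro nn_integral_cong) (auto split: split_indicator)

lemma dom_form_iff:
  "f \<in> dom_form \<delta> \<mu> \<longleftrightarrow> f \<in> L2 \<mu> \<and>
    integrable (\<mu> \<Otimes>\<^sub>M \<mu>) (\<lambda>(x, y). (f x - f y)\<^sup>2 / dist x y powr \<delta>)"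
proof (cases "f \<in> L2 \<mu>")
  case True
  note [measurable] = L2_measurable[OF True]
  have "(\<integral>\<^sup>+x. (\<integral>\<^sup>+y\<in>-{x}. ennreal (\<bar>f x - f y\<bar>\<^sup>2 / dist x y powr \<delta>) \<partial>\<mu>) \<partial>\<mu>)
      = (\<integral>\<^sup>+x. (\<integral>\<^sup>+y. ennreal ((f x - f y)\<^sup>2 / dist x y powr \<delta>) \<partial>\<mu>) \<partial>\<mu>)"
    by (simp add: nn_integral_off_diagonal)
  also have "\<dots> = (\<integral>\<^sup>+z. ennreal (norm (case z of (x, y) \<Rightarrow> (f x - f y)\<^sup>2 / dist x y powr \<delta>)) \<partial>(\<mu> \<Otimes>\<^sub>M \<mu>))"
    by (subst nn_integral_fst[symmetric]) auto
  finally show ?thesis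
    using True by (simp add: dom_form_def integrable_iff_bounded)
qed (simp add: dom_form_def)

lemma dom_form_subset_L2: "f \<in> dom_form \<delta> \<mu> \<Longrightarrow> f \<in> L2 \<mu>"
  by (simp add: dom_form_iff)

lemma one_in_dom_form: "(\<lambda>_. 1) \<in> dom_form \<delta> \<mu>"
  by (simp add: dom_form_iff L2_def split_beta')

lemma integrable_form:
  assumes "f \<in> dom_form \<delta> \<mu>" "g \<in> dom_form \<delta> \<mu>"
  shows "integrable (\<mu> \<Otimes>\<^sub>M \<mu>) (\<lambda>(x, y). (f x - f y) * (g x - g y) / dist x y powr \<delta>)"
proof (rule Bochner_Integration.integrable_bound)
  note [measurable] = assms[THEN dom_form_subset_L2, THEN L2_measurable]
  show "integrable (\<mu> \<Otimes>\<^sub>M \<mu>)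
      (\<lambda>z. ((case z of (x, y) \<Rightarrow> (f x - f y)\<^sup>2 / dist x y powr \<delta>) +
            (case z of (x, y) \<Rightarrow> (g x - g y)\<^sup>2 / dist x y powr \<delta>)) / 2)"
    using assms by (intro integrable_divide Bochner_Integration.integrable_add) (simp_all add: dom_form_iff)
  show "(\<lambda>(x, y). (f x - f y) * (g x - g y) / dist x y powr \<delta>) \<in> borel_measurable (\<mu> \<Otimes>\<^sub>M \<mu>)"
    by measurable
  have "\<bar>(f x - f y) * (g x - g y) / dist x y powr \<delta>\<bar>
      \<le> ((f x - f y)\<^sup>2 / dist x y powr \<delta> + (g x - g y)\<^sup>2 / dist x y powr \<delta>) / 2" for x y
    using divide_right_mono[OF abs_mult_le_half_squares[of "f x - f y" "g x - g y"], of "dist x y powr \<delta>"]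
    by (simp add: abs_mult add_divide_distrib)
  then show "AE z in \<mu> \<Otimes>\<^sub>M \<mu>.
      norm (case z of (x, y) \<Rightarrow> (f x - f y) * (g x - g y) / dist x y powr \<delta>) \<le> norm
      (((case z of (x, y) \<Rightarrow> (f x - f y)\<^sup>2 / dist x y powr \<delta>) +
            (case z of (x, y) \<Rightarrow> (g x - g y)\<^sup>2 / dist x y powr \<delta>)) / 2)"
    by auto
qed

lemma log_form_eq_product_integral:
  assumes "f \<in> dom_form \<delta> \<mu>" "g \<in> dom_form \<delta> \<mu>"
  shows "log_form \<delta> \<mu> f g =
    1 / 2 * (\<integral>(x, y). (f x - f y) * (g x - g y) / dist x y powr \<delta> \<partial>(\<mu> \<Otimes>\<^sub>M \<mu>))"
proof -
  have "(LINT y:-{x}|\<mu>. (f x - f y) * (g x - g y) / dist x y powr \<delta>)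
      = (LINT y|\<mu>. (f x - f y) * (g x - g y) / dist x y powr \<delta>)" for x
    unfolding set_lebesgue_integral_def
    by (intro Bochner_Integration.integral_cong) (auto split: split_indicator)
  then show ?thesis
    unfolding pair.integral_fst[OF integrable_form[OF assms], symmetric] log_form_def by simp
qed

section \<open>Lipschitz functions separate integrable functions\<close>

text \<open>The indicator of a proper open set \<open>U\<close> is the pointwise limit of the Lipschitz functions
  \<open>min 1 (n * d(x, X - U))\<close>, so dominated convergence applies. If \<open>U\<close> is the whole space, its
  complement is empty, \<open>infdist\<close> has the default value 0, and the constant 1 takes over.\<close>

lemma integral_open_eq_0:
  fixes w :: "'a \<Rightarrow> real"
  assumes int: "integrable \<mu> w" and "open U"
    and orth: "\<And>g. bounded (range g) \<Longrightarrow> (\<exists>L. L-lipschitz_on UNIV g) \<Longrightarrow> (LINT x|\<mu>. w x * g x) = 0"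
  shows "(LINT x:U|\<mu>. w x) = 0"
proof (cases "U = UNIV")
  case True
  have "1-lipschitz_on UNIV (\<lambda>_::'a. 1::real)"
    by (auto simp: lipschitz_on_def)
  with orth[of "\<lambda>_. 1"] True show ?thesis
    by (auto simp: set_lebesgue_integral_def)
next
  case False
  define g where "g n x = min 1 (real n * infdist x (-U))" for n x
  have [measurable]: "U \<in> sets \<mu>" "w \<in> borel_measurable \<mu>"
    using \<open>open U\<close> int by (auto simp: sets_eq_borel)
  have g_range: "0 \<le> g n x" "g n x \<le> 1" for n x
    by (auto simp: g_def infdist_nonneg)
  have lip: "(real n)-lipschitz_on UNIV (g n)" for n
  proof (rule lipschitz_onI)
    fix x y
    have "\<bar>real n * infdist x (-U) - real n * infdist y (-U)\<bar> \<le> real n * dist x y"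
      using mult_left_mono[OF infdist_triangle_abs[of x "-U" y], of "real n"]
      by (simp add: right_diff_distrib[symmetric] abs_mult)
    then show "dist (g n x) (g n y) \<le> real n * dist x y"
      by (auto simp: g_def dist_real_def min_def)
  qed simp
  have [measurable]: "g n \<in> borel_measurable \<mu>" for n
    using borel_measurable_continuous_onI[OF lipschitz_on_continuous_on[OF lip]]
    by (simp cong: measurable_cong_sets add: sets_eq_borel)
  have lim: "(\<lambda>n. g n x) \<longlonglongrightarrow> indicator U x" for x
  proof (cases "x \<in> U")
    case True
    then have pos: "infdist x (-U) > 0"
      using \<open>open U\<close> False infdist_pos_not_in_closed[of "-U" x] by auto
    then obtain N where N: "1 < real N * infdist x (-U)"
      using reals_Archimedean3 by blast
    have "g n x = 1" if "n \<ge> N" for n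
      using N mult_right_mono[of "real N" "real n" "infdist x (-U)"] pos that
      unfolding g_def by (intro min_absorb1) linarith
    then have "eventually (\<lambda>n. g n x = indicator U x) sequentially"
      using True by (auto simp: eventually_sequentially)
    then show ?thesis
      by (rule tendsto_eventually)
  qed (simp add: g_def)
  have "(\<lambda>n. LINT x|\<mu>. w x * g n x) \<longlonglongrightarrow> (LINT x|\<mu>. w x * indicator U x)"
  proof (rule integral_dominated_convergence)
    show "integrable \<mu> (\<lambda>x. \<bar>w x\<bar>)"
      using int by simp
    show "AE x in \<mu>. norm (w x * g n x) \<le> \<bar>w x\<bar>" for n
      using g_range by (auto simp: abs_mult intro!: mult_left_le)
    show "AE x in \<mu>. (\<lambda>n. w x * g n x) \<longlonglongrightarrow> w x * indicator U x"
      by (intro AE_I2 tendsto_mult_left lim)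
  qed measurable
  moreover have "(LINT x|\<mu>. w x * g n x) = 0" for n
    using lip g_range by (intro orth) (auto intro!: boundedI[of _ 1])
  ultimately have "(LINT x|\<mu>. w x * indicator U x) = 0"
    using LIMSEQ_unique[OF _ tendsto_const[of 0]] by simp
  then show ?thesis
    by (simp add: set_lebesgue_integral_def mult.commute)
qed

text \<open>The open sets form a generator closed under intersections, and the sets over which \<open>w\<close>
  integrates to zero form a Dynkin system.\<close>

lemma AE_eq_0_if_orthogonal_to_lipschitz:
  fixes w :: "'a \<Rightarrow> real"
  assumes int: "integrable \<mu> w"
    and orth: "\<And>g. bounded (range g) \<Longrightarrow> (\<exists>L. L-lipschitz_on UNIV g) \<Longrightarrow> (LINT x|\<mu>. w x * g x) = 0"
  shows "AE x in \<mu>. w x = 0"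
proof (rule density_zero[OF int])
  note opn = integral_open_eq_0[OF int _ orth]
  have w: "set_integrable \<mu> A w" if "A \<in> sets \<mu>" for A
    using integrable_mult_indicator[OF that int] by (simp add: set_integrable_def)
  fix A assume "A \<in> sets \<mu>"
  then have "A \<in> sigma_sets UNIV {U :: 'a set. open U}"
    by (simp add: sets_eq_borel sets_borel)
  have sets: "sigma_sets UNIV {U :: 'a set. open U} = sets \<mu>"
    by (simp add: sets_eq_borel sets_borel)
  have "Int_stable {U :: 'a set. open U}"
    by (auto simp: Int_stable_def)
  moreover have "{U :: 'a set. open U} \<subseteq> Pow UNIV"
    by simp
  ultimately show "(LINT x:A|\<mu>. w x) = 0"
    using \<open>A \<in> sigma_sets _ _\<close>
  proof (induction rule: sigma_sets_induct_disjoint)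
    case (basic A)
    then show ?case
      using opn by auto
  next
    case empty
    then show ?case
      by (simp add: set_lebesgue_integral_def)
  next
    case (compl A)
    have A: "A \<in> sets \<mu>"
      using compl sets by simp
    have "UNIV - A \<in> sets \<mu>"
      using sets.compl_sets[OF A] by simp
    then have "(LINT x:A \<union> (UNIV - A)|\<mu>. w x) = (LINT x:A|\<mu>. w x) + (LINT x:UNIV - A|\<mu>. w x)"
      using w A by (intro set_integral_Un) auto
    then have "(LINT x:UNIV|\<mu>. w x) = (LINT x:A|\<mu>. w x) + (LINT x:UNIV - A|\<mu>. w x)"
      by simp
    then show ?case
      using compl opn by auto
  next
    case (union A)
    then show ?case
      using sets w by (subst lebesgue_integral_countable_add) (auto simp: disjoint_family_on_def)
  qed
qed

end

section \<open>Multipliers whose commutator kernel passes the Schur test\<close>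

text \<open>Everything about the commutator depends on the multiplier only through the row bound of its
  kernel. The same locale serves for the multiplier of the main result and for the Lipschitz test
  functions in the proof of uniqueness.\<close>

locale schur_multiplier = finite_borel_space \<mu>
  for \<mu> :: "'a::{metric_space, second_countable_topology} measure" +
  fixes \<delta> :: real and h :: "'a \<Rightarrow> real" and B M :: real
  assumes multiplier_measurable[measurable]: "h \<in> borel_measurable \<mu>"
    and multiplier_bounded: "\<bar>h x\<bar> \<le> B"
    and multiplier_row_bound: "(\<integral>\<^sup>+y. ennreal (\<bar>h x - h y\<bar> / dist x y powr \<delta>) \<partial>\<mu>) \<le> ennreal M"
    and multiplier_bound_pos: "M > 0"
begin

sublocale schur_kernel \<mu> "\<lambda>x y. (h x - h y) / dist x y powr \<delta>" M
proof
  show "(\<lambda>(x, y). (h x - h y) / dist x y powr \<delta>) \<in> borel_measurable (\<mu> \<Otimes>\<^sub>M \<mu>)"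
    by measurable
  show "(h x - h y) / dist x y powr \<delta> = - ((h y - h x) / dist y x powr \<delta>)" for x y
    unfolding dist_commute[of y x] minus_divide_left by simp
  show "(\<integral>\<^sup>+y. ennreal \<bar>(h x - h y) / dist x y powr \<delta>\<bar> \<partial>\<mu>) \<le> ennreal M" for x
    using multiplier_row_bound by simp
qed (fact multiplier_bound_pos)

lemma mult_op_L2: "f \<in> L2 \<mu> \<Longrightarrow> mult_op h f \<in> L2 \<mu>"
  by (rule L2_mult_bounded[OF _ _ multiplier_bounded]) auto

text \<open>Split \<open>h x f x - h y f y = h x (f x - f y) + (h x - h y) f y\<close>. The first part is controlled by the
  energy of \<open>f\<close>; in the second, one of the two factors \<open>h x - h y\<close> of the square is bounded by \<open>2 B\<close>,
  and the other one produces the kernel, integrable against \<open>(f y)\<^sup>2\<close>.\<close>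

lemma mult_op_dom_form:
  assumes f: "f \<in> dom_form \<delta> \<mu>"
  shows "mult_op h f \<in> dom_form \<delta> \<mu>"
proof -
  note L2 = dom_form_subset_L2[OF f]
  note [measurable] = L2_measurable[OF L2]
  have B: "B \<ge> 0"
    using multiplier_bounded[of undefined] by linarith
  have num: "(h x * f x - h y * f y)\<^sup>2 \<le> 2 * B\<^sup>2 * (f x - f y)\<^sup>2 + 4 * B * (\<bar>h x - h y\<bar> * (f y)\<^sup>2)" for x y
  proof -
    have "(h x * f x - h y * f y)\<^sup>2 = (h x * (f x - f y) + (h x - h y) * f y)\<^sup>2"
      by (simp add: algebra_simps)
    also have "\<dots> \<le> 2 * (h x)\<^sup>2 * (f x - f y)\<^sup>2 + 2 * (h x - h y)\<^sup>2 * (f y)\<^sup>2"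
      using square_add_le[of "h x * (f x - f y)" "(h x - h y) * f y"] by (simp add: power_mult_distrib)
    also have "(h x)\<^sup>2 \<le> B\<^sup>2"
      using multiplier_bounded[of x] B by (simp add: abs_le_square_iff[symmetric])
    also have "(h x - h y)\<^sup>2 \<le> 2 * B * \<bar>h x - h y\<bar>"
      using multiplier_bounded[of x] multiplier_bounded[of y]
        mult_right_mono[of "\<bar>h x - h y\<bar>" "2 * B" "\<bar>h x - h y\<bar>"]
      by (simp add: power2_eq_square)
    finally show ?thesis
      by (simp add: algebra_simps mult_right_mono)
  qed
  have "integrable (\<mu> \<Otimes>\<^sub>M \<mu>) (\<lambda>(x, y). (h x * f x - h y * f y)\<^sup>2 / dist x y powr \<delta>)"
  proof (rule Bochner_Integration.integrable_bound)
    show "integrable (\<mu> \<Otimes>\<^sub>M \<mu>)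
      (\<lambda>z. 2 * B\<^sup>2 * (case z of (x, y) \<Rightarrow> (f x - f y)\<^sup>2 / dist x y powr \<delta>) +
        4 * B * (case z of (x, y) \<Rightarrow> \<bar>(h x - h y) / dist x y powr \<delta>\<bar> * (f y)\<^sup>2))"
      using f integrable_kernel_square(1)[OF L2]
      by (intro integrable_mult_right Bochner_Integration.integrable_add) (simp_all add: dom_form_iff)
    show "(\<lambda>(x, y). (h x * f x - h y * f y)\<^sup>2 / dist x y powr \<delta>) \<in> borel_measurable (\<mu> \<Otimes>\<^sub>M \<mu>)"
      by measurable
    have "(h x * f x - h y * f y)\<^sup>2 / dist x y powr \<delta> \<le>
       2 * B\<^sup>2 * ((f x - f y)\<^sup>2 / dist x y powr \<delta>) + 4 * B * (\<bar>(h x - h y) / dist x y powr \<delta>\<bar> * (f y)\<^sup>2)" for x y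
      using divide_right_mono[OF num[of x y], of "dist x y powr \<delta>"] by (simp add: add_divide_distrib)
    then show "AE z in \<mu> \<Otimes>\<^sub>M \<mu>. norm (case z of (x, y) \<Rightarrow> (h x * f x - h y * f y)\<^sup>2 / dist x y powr \<delta>) \<le> norm
      (2 * B\<^sup>2 * (case z of (x, y) \<Rightarrow> (f x - f y)\<^sup>2 / dist x y powr \<delta>) +
        4 * B * (case z of (x, y) \<Rightarrow> \<bar>(h x - h y) / dist x y powr \<delta>\<bar> * (f y)\<^sup>2))"
      by (intro AE_I2) (clarsimp, rule order_trans[OF _ abs_ge_self], simp)
  qed
  then show ?thesis
    using mult_op_L2[OF L2] by (simp add: dom_form_iff mult_op_def)
qed

text \<open>The difference of the two integrands is \<open>k(x, y) (f y g x - f x g y)\<close>. Both terms contribute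
  \<open>\<langle>T f, g\<rangle>\<close>, by skew-adjointness, which cancels the factor \<open>1/2\<close> in the form.\<close>

lemma log_form_mult_op:
  assumes f: "f \<in> dom_form \<delta> \<mu>" and g: "g \<in> dom_form \<delta> \<mu>"
  shows "log_form \<delta> \<mu> (mult_op h f) g = log_form \<delta> \<mu> f (mult_op h g) + L2_inner \<mu> (integral_op f) g"
proof -
  note L2 = f[THEN dom_form_subset_L2] g[THEN dom_form_subset_L2]
  let ?k = "\<lambda>x y. (h x - h y) / dist x y powr \<delta>"
  note 1 = integrable_form[OF mult_op_dom_form[OF f] g]
  note 2 = integrable_form[OF f mult_op_dom_form[OF g]]
  have 3: "integrable (\<mu> \<Otimes>\<^sub>M \<mu>) (\<lambda>(x, y). ?k x y * f x * g y)"
    using integrable_bilinear[OF L2(2,1)] by (simp add: mult_ac)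
  note 4 = integrable_bilinear[OF L2]
  have "(H * a - K * b) * (G - L) / d - (a - b) * (H * G - K * L) / d
      = (H - K) / d * b * G - (H - K) / d * a * L" for H K a b G L d :: real
    by (simp add: diff_divide_distrib[symmetric] algebra_simps)
  then have pointwise: "(\<lambda>z. (case z of (x, y) \<Rightarrow> (mult_op h f x - mult_op h f y) * (g x - g y) / dist x y powr \<delta>)
       - (case z of (x, y) \<Rightarrow> (f x - f y) * (mult_op h g x - mult_op h g y) / dist x y powr \<delta>))
      = (\<lambda>z. (case z of (x, y) \<Rightarrow> ?k x y * f y * g x) - (case z of (x, y) \<Rightarrow> ?k x y * f x * g y))"
    by (auto simp: mult_op_def)
  have "2 * log_form \<delta> \<mu> (mult_op h f) g - 2 * log_form \<delta> \<mu> f (mult_op h g)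
     = (\<integral>(x, y). ?k x y * f y * g x \<partial>(\<mu> \<Otimes>\<^sub>M \<mu>)) - (\<integral>(x, y). ?k x y * f x * g y \<partial>(\<mu> \<Otimes>\<^sub>M \<mu>))"
    unfolding Bochner_Integration.integral_diff[OF 4 3, symmetric] pointwise[symmetric]
      Bochner_Integration.integral_diff[OF 1 2]
    by (simp add: log_form_eq_product_integral f g mult_op_dom_form)
  also have "\<dots> = 2 * L2_inner \<mu> (integral_op f) g"
    unfolding L2_inner_integral_op[OF L2, symmetric] LINT_kernel_swap[OF L2] by simp
  finally show ?thesis
    by simp
qed

text \<open>Test the equation for \<open>u\<close> against \<open>h g\<close> and move \<open>h\<close> to the other side.\<close>

lemma is_resolvent_mult_op:
  assumes "is_resolvent \<delta> \<mu> F u"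
  shows "is_resolvent \<delta> \<mu> (\<lambda>x. mult_op h F x + integral_op u x) (mult_op h u)"
proof -
  from assms have F: "F \<in> L2 \<mu>" and u: "u \<in> dom_form \<delta> \<mu>"
    and eq: "\<And>g. g \<in> dom_form \<delta> \<mu> \<Longrightarrow> L2_inner \<mu> u g + log_form \<delta> \<mu> u g = L2_inner \<mu> F g"
    by (auto simp: is_resolvent_def)
  note T = integral_op_L2(1)[OF dom_form_subset_L2[OF u]]
  have adj: "L2_inner \<mu> (mult_op h v) g = L2_inner \<mu> v (mult_op h g)" for v g
    by (simp add: L2_inner_def mult_op_def mult_ac)
  show ?thesis
    unfolding is_resolvent_def
  proof (intro conjI ballI)
    show "(\<lambda>x. mult_op h F x + integral_op u x) \<in> L2 \<mu>"
      by (intro L2_add mult_op_L2 F T)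
    show "mult_op h u \<in> dom_form \<delta> \<mu>"
      by (intro mult_op_dom_form u)
    fix g assume g: "g \<in> dom_form \<delta> \<mu>"
    have "L2_inner \<mu> (\<lambda>x. mult_op h F x + integral_op u x) g
        = L2_inner \<mu> (mult_op h F) g + L2_inner \<mu> (integral_op u) g"
      unfolding L2_inner_def distrib_right
      by (intro Bochner_Integration.integral_add L2_integrable_mult mult_op_L2 F T dom_form_subset_L2[OF g])
    then show "L2_inner \<mu> (mult_op h u) g + log_form \<delta> \<mu> (mult_op h u) g
        = L2_inner \<mu> (\<lambda>x. mult_op h F x + integral_op u x) g"
      using eq[OF mult_op_dom_form[OF g]] by (simp add: adj log_form_mult_op[OF u g])
  qed
qed

end

section \<open>The modulus of continuity\<close>

lemma modulus_bdd_above: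
  fixes h :: "'a::metric_space \<Rightarrow> real"
  assumes "bounded (range h)"
  shows "bdd_above {\<bar>h x - h y\<bar> | x y. dist x y \<le> t * diameter (UNIV :: 'a set)}"
proof -
  from assms obtain B where "\<bar>h x\<bar> \<le> B" for x
    by (auto simp: bounded_iff)
  then have "\<bar>h x - h y\<bar> \<le> B + B" for x y
    using abs_triangle_ineq4[of "h x" "h y"] by (meson add_mono order_trans)
  then show ?thesis
    by (intro bdd_aboveI[of _ "B + B"]) auto
qed

lemma abs_diff_le_modulus:
  fixes h :: "'a::metric_space \<Rightarrow> real"
  assumes "bounded (range h)" "dist x y \<le> t * diameter (UNIV :: 'a set)"
  shows "\<bar>h x - h y\<bar> \<le> modulus_of_continuity h t"
  unfolding modulus_of_continuity_def using assms modulus_bdd_above[OF assms(1)]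
  by (intro cSup_upper) auto

lemma modulus_nonneg:
  fixes h :: "'a::metric_space \<Rightarrow> real"
  assumes "bounded (UNIV :: 'a set)" "bounded (range h)" "0 \<le> t"
  shows "0 \<le> modulus_of_continuity h t"
  using abs_diff_le_modulus[OF assms(2), of undefined undefined t] assms by (simp add: diameter_ge_0)

lemma modulus_mono:
  fixes h :: "'a::metric_space \<Rightarrow> real"
  assumes "bounded (UNIV :: 'a set)" "bounded (range h)" "0 \<le> s" "s \<le> t"
  shows "modulus_of_continuity h s \<le> modulus_of_continuity h t"
  unfolding modulus_of_continuity_def[of h s]
proof (rule cSup_least)
  have "dist undefined (undefined :: 'a) \<le> s * diameter (UNIV :: 'a set)"
    using assms by (simp add: diameter_ge_0)
  then show "{\<bar>h x - h y\<bar> | x y. dist x y \<le> s * diameter (UNIV :: 'a set)} \<noteq> {}"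
    by blast
  have "s * diameter (UNIV :: 'a set) \<le> t * diameter (UNIV :: 'a set)"
    using assms by (intro mult_right_mono diameter_ge_0)
  then show "a \<le> modulus_of_continuity h t"
    if "a \<in> {\<bar>h x - h y\<bar> | x y. dist x y \<le> s * diameter (UNIV :: 'a set)}" for a
    using that abs_diff_le_modulus[OF assms(2)] by force
qed

text \<open>On \<open>(2\<^sup>-\<^sup>n\<^sup>-\<^sup>1, 2\<^sup>-\<^sup>n]\<close> monotonicity gives \<open>\<omega>(t) / t \<ge> 2\<^sup>n \<omega>(2\<^sup>-\<^sup>n\<^sup>-\<^sup>1)\<close>, and the interval has length
  \<open>2\<^sup>-\<^sup>n\<^sup>-\<^sup>1\<close>. Hence the Dini integral dominates half the sum of the \<open>\<omega>(2\<^sup>-\<^sup>n\<^sup>-\<^sup>1)\<close>. Comparing with the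
  step function of these lower bounds avoids any question about the measurability of \<open>\<omega>\<close>.\<close>

lemma summable_modulus:
  fixes h :: "'a::metric_space \<Rightarrow> real"
  assumes bdd: "bounded (UNIV :: 'a set)" and dini: "dini_continuous h"
  shows "summable (\<lambda>n. modulus_of_continuity h (1 / 2 ^ n))"
proof -
  let ?\<omega> = "modulus_of_continuity h"
  define a where "a n = ?\<omega> (1 / 2 ^ Suc n)" for n
  define I where "I n = {1 / 2 ^ Suc n <.. 1 / 2 ^ n :: real}" for n
  from dini have h: "bounded (range h)"
    and fin: "(\<integral>\<^sup>+t\<in>{0<..1}. ennreal (?\<omega> t / t) \<partial>lborel) < \<infinity>"
    by (auto simp: dini_continuous_def)
  have a: "a n \<ge> 0" for n
    unfolding a_def by (intro modulus_nonneg bdd h) simp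
  have step: "(\<Sum>n. ennreal (a n * 2 ^ n) * indicator (I n) t)
      \<le> ennreal (?\<omega> t / t) * indicator {0<..1} t" for t
  proof (cases "\<exists>m. t \<in> I m")
    case True
    then obtain m where m: "t \<in> I m" ..
    have disj: "t \<notin> I n" if "n \<noteq> m" for n
    proof
      assume n: "t \<in> I n"
      have no: False if "t \<in> I i" "t \<in> I j" "i < j" for i j
      proof -
        have "(1 / 2 ^ j :: real) \<le> 1 / 2 ^ Suc i"
          using that(3) by (intro divide_left_mono power_increasing) auto
        then show False
          using that(1,2) by (auto simp: I_def)
      qed
      from that have "n < m \<or> m < n" by auto
      then show False
        using no m n by blast
    qed
    have "0 < (1 / 2 ^ Suc m :: real)" "(1 / 2 ^ m :: real) \<le> 1"
      by simp_all
    moreover have "1 / 2 ^ Suc m < t" "t \<le> 1 / 2 ^ m"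
      using m unfolding I_def greaterThanAtMost_iff by blast+
    ultimately have t: "0 < t" "t \<le> 1" "1 / 2 ^ Suc m \<le> t" "t \<le> 1 / 2 ^ m"
      by linarith+
    have "(\<Sum>n. ennreal (a n * 2 ^ n) * indicator (I n) t)
        = (\<Sum>n\<in>{m}. ennreal (a n * 2 ^ n) * indicator (I n) t)"
      by (rule suminf_finite) (auto simp: disj)
    also have "\<dots> = ennreal (a m * 2 ^ m)"
      using m by simp
    also have "\<dots> \<le> ennreal (?\<omega> t / t)"
    proof (rule ennreal_leI)
      have "a m * 2 ^ m \<le> ?\<omega> t * 2 ^ m"
        unfolding a_def using t by (intro mult_right_mono modulus_mono bdd h) simp_all
      also have "\<dots> \<le> ?\<omega> t * (1 / t)"
        using t by (intro mult_left_mono modulus_nonneg bdd h) (simp_all add: field_simps)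
      finally show "a m * 2 ^ m \<le> ?\<omega> t / t"
        by simp
    qed
    finally show ?thesis
      using t by simp
  qed simp
  have "(\<Sum>n. ennreal (a n / 2)) = (\<Sum>n. \<integral>\<^sup>+t. ennreal (a n * 2 ^ n) * indicator (I n) t \<partial>lborel)"
  proof (rule suminf_cong)
    fix n
    have "emeasure lborel (I n) = ennreal (1 / 2 ^ n - 1 / 2 ^ Suc n)"
      unfolding I_def by (rule emeasure_lborel_Ioc) (simp add: field_simps)
    moreover have "I n \<in> sets lborel"
      by (simp add: I_def)
    ultimately have "(\<integral>\<^sup>+t. ennreal (a n * 2 ^ n) * indicator (I n) t \<partial>lborel)
        = ennreal (a n * 2 ^ n) * ennreal (1 / 2 ^ n - 1 / 2 ^ Suc n)"
      by (simp add: nn_integral_cmult_indicator)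
    also have "\<dots> = ennreal (a n * 2 ^ n * (1 / 2 ^ n - 1 / 2 ^ Suc n))"
      using a by (intro ennreal_mult[symmetric]) (simp_all add: field_simps)
    also have "a n * 2 ^ n * (1 / 2 ^ n - 1 / 2 ^ Suc n) = a n / 2"
      by (simp add: field_simps)
    finally show "ennreal (a n / 2) = (\<integral>\<^sup>+t. ennreal (a n * 2 ^ n) * indicator (I n) t \<partial>lborel)" ..
  qed
  also have "\<dots> = (\<integral>\<^sup>+t. (\<Sum>n. ennreal (a n * 2 ^ n) * indicator (I n) t) \<partial>lborel)"
    by (intro nn_integral_suminf[symmetric]) (simp add: I_def)
  also have "\<dots> \<le> (\<integral>\<^sup>+t\<in>{0<..1}. ennreal (?\<omega> t / t) \<partial>lborel)"
    by (intro nn_integral_mono step)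
  finally have "(\<Sum>n. ennreal (a n / 2)) \<noteq> top"
    using fin by auto
  then have "summable (\<lambda>n. a n / 2)"
    using a by (intro summable_suminf_not_top) auto
  then have "summable a"
    using summable_mult[of "\<lambda>n. a n / 2" 2] by simp
  then show ?thesis
    unfolding a_def by (subst (asm) summable_Suc_iff)
qed

lemma lipschitz_imp_dini:
  fixes h :: "'a::metric_space \<Rightarrow> real"
  assumes bdd: "bounded (UNIV :: 'a set)" and h: "bounded (range h)" and lip: "L-lipschitz_on UNIV h"
  shows "dini_continuous h"
proof -
  let ?D = "diameter (UNIV :: 'a set)"
  have L: "L \<ge> 0"
    using lip by (rule lipschitz_on_nonneg)
  have \<omega>: "modulus_of_continuity h t / t \<le> L * ?D" if "0 < t" for t
  proof -
    have "modulus_of_continuity h t \<le> L * (t * ?D)"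
      unfolding modulus_of_continuity_def
    proof (rule cSup_least)
      have "dist undefined (undefined :: 'a) \<le> t * ?D"
        using that bdd by (simp add: diameter_ge_0)
      then show "{\<bar>h x - h y\<bar> | x y. dist x y \<le> t * ?D} \<noteq> {}"
        by blast
      show "a \<le> L * (t * ?D)" if a: "a \<in> {\<bar>h x - h y\<bar> | x y. dist x y \<le> t * ?D}" for a
      proof -
        from a obtain x y where a_eq: "a = \<bar>h x - h y\<bar>" and xy: "dist x y \<le> t * ?D"
          by blast
        have "a \<le> L * dist x y"
          using lipschitz_onD[OF lip, of x y] by (simp add: a_eq dist_real_def)
        also have "\<dots> \<le> L * (t * ?D)"
          using xy L by (rule mult_left_mono)
        finally show ?thesis .
      qed
    qed
    with that show ?thesis
      by (simp add: field_simps)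
  qed
  have "(\<integral>\<^sup>+t\<in>{0<..1}. ennreal (modulus_of_continuity h t / t) \<partial>lborel)
      \<le> (\<integral>\<^sup>+t. ennreal (L * ?D) * indicator {0<..1::real} t \<partial>lborel)"
    using \<omega> by (intro nn_integral_mono) (auto split: split_indicator intro!: ennreal_leI)
  also have "\<dots> < \<infinity>"
    by (simp add: nn_integral_cmult_indicator ennreal_mult_less_top)
  finally show ?thesis
    using h lipschitz_on_uniformly_continuous[OF lip] by (simp add: dini_continuous_def)
qed

section \<open>Dini continuous multipliers on regular spaces\<close>

text \<open>In an unbounded space the lower regularity bound would hold for all radii and exceed the finite
  total mass.\<close>

lemma ahlfors_regular_imp_bounded:
  fixes \<mu> :: "'a::metric_space measure"
  assumes "\<delta> > 0" "finite_measure \<mu>" "ahlfors_regular \<delta> \<mu>"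
  shows "bounded (UNIV :: 'a set)"
proof (rule ccontr)
  assume unbounded: "\<not> ?thesis"
  interpret finite_measure \<mu> by fact
  from assms(3) unbounded obtain C where "C \<ge> 1"
    and C: "\<And>x r. 0 \<le> r \<Longrightarrow> inverse C * r powr \<delta> \<le> measure \<mu> (cball x r)"
    by (auto simp: ahlfors_regular_def)
  define m where "m = measure \<mu> (space \<mu>)"
  \<comment> \<open>The radius at which the lower bound equals \<open>m + 1\<close>, one more than the total mass.\<close>
  define r where "r = (C * (m + 1)) powr (1 / \<delta>)"
  have "C * (m + 1) > 0"
    using \<open>C \<ge> 1\<close> by (simp add: m_def add_nonneg_pos)
  then have "r powr \<delta> = C * (m + 1)"
    using \<open>\<delta> > 0\<close> by (simp add: r_def powr_powr)
  moreover have "inverse C * r powr \<delta> \<le> measure \<mu> (cball undefined r)"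
    by (rule C) (simp add: r_def)
  ultimately have "m + 1 \<le> measure \<mu> (cball undefined r)"
    using \<open>C \<ge> 1\<close> by (simp add: mult.assoc[symmetric])
  then show False
    using bounded_measure[of "cball undefined r"] by (simp add: m_def)
qed

context finite_borel_space
begin

text \<open>The dyadic decomposition around \<open>x\<close>. Annuli may be enlarged to balls, because in the upper
  estimate of the kernel by a series only the term of the annulus containing \<open>y\<close> is used.\<close>

lemma dini_row_bound:
  assumes \<delta>: "\<delta> > 0" and reg: "ahlfors_regular \<delta> \<mu>" and dini: "dini_continuous h"
  shows "\<exists>M>0. \<forall>x. (\<integral>\<^sup>+y. ennreal (\<bar>h x - h y\<bar> / dist x y powr \<delta>) \<partial>\<mu>) \<le> ennreal M"
proof -
  let ?D = "diameter (UNIV :: 'a set)" and ?\<omega> = "modulus_of_continuity h"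
  have bdd: "bounded (UNIV :: 'a set)"
    by (rule ahlfors_regular_imp_bounded[OF \<delta> finite_measure_axioms reg])
  have h: "bounded (range h)"
    using dini by (simp add: dini_continuous_def)
  have dist_le: "dist x y \<le> ?D" for x y :: 'a
    using diameter_bounded_bound[OF bdd] by simp
  show ?thesis
  proof (cases "?D = 0")
    case True
    then have "\<bar>h x - h y\<bar> / dist x y powr \<delta> = 0" for x y
      using dist_le[of x y] by simp
    then show ?thesis
      by (intro exI[of _ 1]) (simp only: ennreal_0 nn_integral_const, simp)
  next
    case False
    then have D: "?D > 0"
      using diameter_ge_0[OF bdd] by simp
    obtain C where C: "C \<ge> 1" "\<And>x r. 0 \<le> r \<Longrightarrow> r < ?D \<Longrightarrow> measure \<mu> (cball x r) \<le> C * r powr \<delta>"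
      using reg by (auto simp: ahlfors_regular_def)
    \<comment> \<open>Regularity says nothing about the radius \<open>D\<close> itself, which is that of the outermost ball; the
      extra summand makes the upper bound hold there, too.\<close>
    define C' where "C' = C + measure \<mu> UNIV / ?D powr \<delta>"
    have C'_pos: "C' > 0"
      using C(1) by (simp add: C'_def add_pos_nonneg)
    have C': "measure \<mu> (cball x r) \<le> C' * r powr \<delta>" if "0 \<le> r" "r \<le> ?D" for x r
    proof (cases "r = ?D")
      case True
      have "measure \<mu> (cball x r) \<le> measure \<mu> UNIV"
        using bounded_measure by simp
      also have "\<dots> \<le> C' * r powr \<delta>"
        using C(1) D by (simp add: True C'_def distrib_right)
      finally show ?thesis .
    next
      case False
      then have "measure \<mu> (cball x r) \<le> C * r powr \<delta>"
        using that by (intro C) auto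
      also have "\<dots> \<le> C' * r powr \<delta>"
        by (intro mult_right_mono) (simp_all add: C'_def)
      finally show ?thesis .
    qed
    have \<omega>: "?\<omega> (1 / 2 ^ n) \<ge> 0" for n
      by (intro modulus_nonneg bdd h) simp
    define b where "b n = ?\<omega> (1 / 2 ^ n) / (?D / 2 ^ Suc n) powr \<delta>" for n
    have b: "b n \<ge> 0" for n
      using \<omega> by (simp add: b_def)
    have pointwise: "ennreal (\<bar>h x - h y\<bar> / dist x y powr \<delta>)
        \<le> (\<Sum>n. ennreal (b n) * indicator (cball x (?D / 2 ^ n)) y)" for x y
    proof (cases "x = y")
      case False
      have ex: "\<exists>n. ?D / 2 ^ Suc n < dist x y"
      proof -
        obtain n where "(1 / 2) ^ n < dist x y / ?D"
          using real_arch_pow_inv[of "dist x y / ?D" "1 / 2"] False D by auto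
        then have "?D / 2 ^ n < dist x y"
          using D by (simp add: field_simps)
        moreover have "?D / 2 ^ Suc n \<le> ?D / 2 ^ n"
          using D by (simp add: field_simps)
        ultimately show ?thesis
          by (meson le_less_trans)
      qed
      \<comment> \<open>The index of the annulus containing \<open>y\<close>.\<close>
      define n where "n = (LEAST n. ?D / 2 ^ Suc n < dist x y)"
      have lower: "?D / 2 ^ Suc n < dist x y"
        unfolding n_def by (rule LeastI_ex[OF ex])
      have upper: "dist x y \<le> ?D / 2 ^ n"
      proof (cases n)
        case (Suc m)
        then have "\<not> ?D / 2 ^ Suc m < dist x y"
          using not_less_Least[of m "\<lambda>n. ?D / 2 ^ Suc n < dist x y"] by (simp add: n_def)
        then show ?thesis
          by (simp add: Suc)
      qed (simp add: dist_le)
      have "\<bar>h x - h y\<bar> \<le> ?\<omega> (1 / 2 ^ n)"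
        using upper by (intro abs_diff_le_modulus h) simp
      moreover have "(?D / 2 ^ Suc n) powr \<delta> \<le> dist x y powr \<delta>"
        using lower D \<delta> by (intro powr_mono2) auto
      ultimately have "\<bar>h x - h y\<bar> / dist x y powr \<delta> \<le> b n"
        unfolding b_def using D \<omega> by (intro frac_le) auto
      then have "ennreal (\<bar>h x - h y\<bar> / dist x y powr \<delta>)
          \<le> (\<Sum>n\<in>{n}. ennreal (b n) * indicator (cball x (?D / 2 ^ n)) y)"
        using upper by (simp add: ennreal_leI)
      also have "\<dots> \<le> (\<Sum>n. ennreal (b n) * indicator (cball x (?D / 2 ^ n)) y)"
        by (intro sum_le_suminf) auto
      finally show ?thesis .
    qed simp
    \<comment> \<open>Adding 1 only makes the bound positive; for a constant \<open>h\<close> the series is 0.\<close>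
    define M where "M = 2 powr \<delta> * C' * (\<Sum>n. ?\<omega> (1 / 2 ^ n)) + 1"
    have term_le: "ennreal (b n) * emeasure \<mu> (cball x (?D / 2 ^ n)) \<le> ennreal (2 powr \<delta> * C' * ?\<omega> (1 / 2 ^ n))" for x n
    proof -
      have "b n * measure \<mu> (cball x (?D / 2 ^ n)) \<le> b n * (C' * (?D / 2 ^ n) powr \<delta>)"
        using D b by (intro mult_left_mono C') (simp_all add: field_simps)
      also have "\<dots> = ?\<omega> (1 / 2 ^ n) * C' * ((?D / 2 ^ n) / (?D / 2 ^ Suc n)) powr \<delta>"
        using D by (subst powr_divide) (auto simp: b_def)
      also have "(?D / 2 ^ n) / (?D / 2 ^ Suc n) = 2"
        using D by (simp add: field_simps)
      finally show ?thesis
        using b by (simp add: emeasure_eq_measure ennreal_mult'[symmetric] ennreal_leI mult_ac)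
    qed
    have summable: "summable (\<lambda>n. 2 powr \<delta> * C' * ?\<omega> (1 / 2 ^ n))"
      by (intro summable_mult summable_modulus bdd dini)
    have "(\<integral>\<^sup>+y. ennreal (\<bar>h x - h y\<bar> / dist x y powr \<delta>) \<partial>\<mu>) \<le> ennreal M" for x
    proof -
      have [measurable]: "cball x r \<in> sets \<mu>" for r
        by (simp add: sets_eq_borel)
      have "(\<integral>\<^sup>+y. ennreal (\<bar>h x - h y\<bar> / dist x y powr \<delta>) \<partial>\<mu>)
          \<le> (\<integral>\<^sup>+y. (\<Sum>n. ennreal (b n) * indicator (cball x (?D / 2 ^ n)) y) \<partial>\<mu>)"
        by (intro nn_integral_mono pointwise)
      also have "\<dots> = (\<Sum>n. ennreal (b n) * emeasure \<mu> (cball x (?D / 2 ^ n)))"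
        by (subst nn_integral_suminf) (auto simp: nn_integral_cmult_indicator)
      also have "\<dots> \<le> (\<Sum>n. ennreal (2 powr \<delta> * C' * ?\<omega> (1 / 2 ^ n)))"
        by (intro suminf_le term_le) auto
      also have "\<dots> = ennreal (\<Sum>n. 2 powr \<delta> * C' * ?\<omega> (1 / 2 ^ n))"
        using C'_pos \<omega> by (intro suminf_ennreal2 summable) auto
      also have "\<dots> \<le> ennreal M"
        unfolding M_def by (subst suminf_mult) (auto intro!: ennreal_leI summable_modulus bdd dini)
      finally show ?thesis .
    qed
    moreover have "M > 0"
      unfolding M_def using C'_pos \<omega>
      by (intro add_nonneg_pos mult_nonneg_nonneg suminf_nonneg summable_modulus bdd dini) auto
    ultimately show ?thesis
      by blast
  qed
qed

lemma dini_schur_multiplier: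
  assumes "\<delta> > 0" "ahlfors_regular \<delta> \<mu>" and dini: "dini_continuous h"
  shows "\<exists>B M. schur_multiplier \<mu> \<delta> h B M"
proof -
  obtain M where "M > 0" "\<And>x. (\<integral>\<^sup>+y. ennreal (\<bar>h x - h y\<bar> / dist x y powr \<delta>) \<partial>\<mu>) \<le> ennreal M"
    using dini_row_bound[OF assms] by blast
  moreover obtain B where "\<And>x. \<bar>h x\<bar> \<le> B"
    using dini by (auto simp: dini_continuous_def bounded_iff)
  moreover have "h \<in> borel_measurable \<mu>"
    using dini borel_measurable_continuous_onI[OF uniformly_continuous_imp_continuous, of h]
    by (simp add: dini_continuous_def sets_eq_borel cong: measurable_cong_sets)
  ultimately have "schur_multiplier \<mu> \<delta> h B M"
    by unfold_locales
  then show ?thesis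
    by blast
qed

text \<open>This is injectivity of the resolvent. Bounded Lipschitz functions are in the form domain,
  being products of themselves, as Dini continuous multipliers, with the constant 1.\<close>

lemma is_resolvent_unique:
  assumes \<delta>: "\<delta> > 0" and reg: "ahlfors_regular \<delta> \<mu>"
    and F: "is_resolvent \<delta> \<mu> F u" and G: "is_resolvent \<delta> \<mu> G u"
  shows "AE x in \<mu>. F x = G x"
proof -
  have bdd: "bounded (UNIV :: 'a set)"
    by (rule ahlfors_regular_imp_bounded[OF \<delta> finite_measure_axioms reg])
  have L2: "F \<in> L2 \<mu>" "G \<in> L2 \<mu>"
    using F G by (auto simp: is_resolvent_def)
  have one: "(\<lambda>_. 1) \<in> L2 \<mu>"
    by (rule dom_form_subset_L2[OF one_in_dom_form])
  have "AE x in \<mu>. F x - G x = 0"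
  proof (rule AE_eq_0_if_orthogonal_to_lipschitz)
    show "integrable \<mu> (\<lambda>x. F x - G x)"
      using L2[THEN L2_integrable_mult[OF _ one]] by simp
    fix g :: "'a \<Rightarrow> real"
    assume "bounded (range g)" "\<exists>L. L-lipschitz_on UNIV g"
    then have "dini_continuous g"
      using lipschitz_imp_dini[OF bdd] by blast
    then obtain B M where "schur_multiplier \<mu> \<delta> g B M"
      using dini_schur_multiplier[OF \<delta> reg] by blast
    then have g: "g \<in> dom_form \<delta> \<mu>"
      using schur_multiplier.mult_op_dom_form[OF _ one_in_dom_form] by (simp add: mult_op_def)
    then have "L2_inner \<mu> F g = L2_inner \<mu> G g"
      using F G by (simp add: is_resolvent_def)
    then show "(LINT x|\<mu>. (F x - G x) * g x) = 0"
      using L2[THEN L2_integrable_mult[OF _ dom_form_subset_L2[OF g]]]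
      by (simp add: L2_inner_def left_diff_distrib)
  qed
  then show ?thesis
    by simp
qed

end

theorem theorem2:
  fixes \<mu> :: "('a::{metric_space, second_countable_topology}) measure"
    and \<delta> :: real
    and h :: "'a \<Rightarrow> real"
  assumes "\<delta> > 0"
    and "metric_measure_space \<mu>"
    and "ahlfors_regular \<delta> \<mu>"
    and "dini_continuous h"
  shows "(\<forall>f\<in>dom_laplacian \<delta> \<mu>. mult_op h f \<in> dom_laplacian \<delta> \<mu>) \<and>
    (\<exists>T. L2_bounded_operator \<mu> T \<and>
      (\<forall>f\<in>dom_laplacian \<delta> \<mu>.
        AE x in \<mu>. T f x = commutator (log_laplacian \<delta> \<mu>) (mult_op h) f x))"
proof -
  interpret finite_borel_space \<mu>
    using assms(2) by (simp add: metric_measure_space_def finite_borel_space_def finite_borel_space_axioms_def)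
  obtain B M where "schur_multiplier \<mu> \<delta> h B M"
    using dini_schur_multiplier[OF assms(1,3,4)] by blast
  then interpret schur_multiplier \<mu> \<delta> h B M .
  have "AE x in \<mu>. integral_op f x = commutator (log_laplacian \<delta> \<mu>) (mult_op h) f x"
    if "f \<in> dom_laplacian \<delta> \<mu>" for f
  proof -
    let ?R = "\<lambda>u. SOME F. is_resolvent \<delta> \<mu> F u"
    from that have "is_resolvent \<delta> \<mu> (?R f) f"
      unfolding dom_laplacian_def mem_Collect_eq by (rule someI_ex)
    then have *: "is_resolvent \<delta> \<mu> (\<lambda>x. mult_op h (?R f) x + integral_op f x) (mult_op h f)"
      by (rule is_resolvent_mult_op)
    then have "is_resolvent \<delta> \<mu> (?R (mult_op h f)) (mult_op h f)"
      by (rule someI[where P = "\<lambda>F. is_resolvent \<delta> \<mu> F (mult_op h f)"])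
    from is_resolvent_unique[OF assms(1,3) this *] show ?thesis
      by eventually_elim (simp add: commutator_def log_laplacian_def mult_op_def right_diff_distrib)
  qed
  moreover have "mult_op h f \<in> dom_laplacian \<delta> \<mu>" if "f \<in> dom_laplacian \<delta> \<mu>" for f
    using that is_resolvent_mult_op by (auto simp: dom_laplacian_def)
  ultimately show ?thesis
    using integral_op_bounded by blast
qed

end
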